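(* The ordered Bell numbers satisfy $$\operatorname{Bell}(m)\sim\frac{m!}{2(\ln 2)^{m+1}}\qquad\text{as } m\to\infty.$$
   Context: The ordered Bell (Fubini) numbers are $\operatorname{Bell}(m)=\sum_{k=0}^{m} S(m,k)\,k!$ for $m\ge 0$, where $S(m,k)$ is the Stirling number of the second kind (number of partitions of an $m$-element set into $k$ nonempty blocks). The notation $a_m\sim b_m$ means $a_m/b_m\to1$. *)

theory Defs
  imports
    Complex_Main
    "HOL-Combinatorics.Stirling"
    "HOL-Library.Disjoint_Sets"
    "HOL-Library.Landau_Symbols"
begin

definition ordered_Bell :: "nat \<Rightarrow> nat" where
  "ordered_Bell m = (\<Sum>k=0..m. Stirling m k * fact k)"

text \<open>
  The library introduces \<^const>\<open>Stirling\<close> by its recurrence. The following facts establish that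
  \<^term>\<open>Stirling m k\<close> is the number of partitions of an \<^term>\<open>m\<close>-element set into \<^term>\<open>k\<close>
  nonempty blocks.
\<close>

definition partitions_into :: "'a set \<Rightarrow> nat \<Rightarrow> 'a set set set" where
  "partitions_into A k = {P. partition_on A P \<and> card P = k}"

lemma finite_partitions_into:
  assumes "finite A"
  shows "finite (partitions_into A k)"
proof (rule finite_subset)
  show "partitions_into A k \<subseteq> Pow (Pow A)"
    by (auto simp: partitions_into_def partition_on_def)
qed (use assms in auto)

lemma partitions_into_insert:
  assumes A: "finite A" and a: "a \<notin> A"
  shows "partitions_into (insert a A) (Suc k) =
           insert {a} ` partitions_into A k \<union>
           (\<lambda>(P, B). insert (insert a B) (P - {B})) ` (SIGMA P:partitions_into A (Suc k). P)"
    (is "?L = ?R1 \<union> ?R2")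
proof (intro equalityI subsetI)
  fix Q assume "Q \<in> ?L"
  then have Q: "\<Union>Q = insert a A" "disjoint Q" "{} \<notin> Q" "card Q = Suc k"
    by (auto simp: partitions_into_def partition_on_def)
  have finQ: "finite Q" using Q(4) card.infinite by fastforce
  obtain C where C: "C \<in> Q" "a \<in> C" using Q(1) by blast
  have uniq: "D = C" if "D \<in> Q" "x \<in> D" "x \<in> C" for D x
    using Q(2) C(1) that by (meson disjointD disjoint_iff)
  have noa: "a \<notin> D" if "D \<in> Q - {C}" for D
    using uniq C that by blast
  have cardQC: "card (Q - {C}) = k" using Q(4) C(1) finQ by simp
  have disjQC: "disjoint (Q - {C})"
    using Q(2) by (auto simp: disjoint_def)
  have U: "\<Union>(Q - {C}) = A - C"
  proof (intro equalityI subsetI)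
    fix x assume "x \<in> \<Union>(Q - {C})"
    then obtain D where D: "D \<in> Q" "D \<noteq> C" "x \<in> D" by blast
    then have "x \<notin> C" "x \<in> insert a A" using uniq Q(1) by auto
    then show "x \<in> A - C" using C by auto
  next
    fix x assume x: "x \<in> A - C"
    then have "x \<in> \<Union>Q" using Q(1) by simp
    then show "x \<in> \<Union>(Q - {C})" using x by auto
  qed
  show "Q \<in> ?R1 \<union> ?R2"
  proof (cases "C = {a}")
    case True
    have "Q - {C} \<in> partitions_into A k"
      using U True a cardQC disjQC Q(3) by (auto simp: partitions_into_def partition_on_def)
    moreover have "Q = insert {a} (Q - {C})" using True C by blast
    ultimately show ?thesis by blast
  next
    case False
    define B where "B = C - {a}"
    have CB: "C = insert a B" "a \<notin> B" "B \<noteq> {}" using C False by (auto simp: B_def)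
    have BQ: "B \<notin> Q" using uniq[of B] CB by blast
    have BA: "B \<subseteq> A" using Q(1) C by (auto simp: B_def)
    define P where "P = insert B (Q - {C})"
    have "\<Union>P = A" using U BA CB a by (auto simp: P_def)
    moreover have "disjoint P"
    proof -
      have "D \<inter> B = {}" if "D \<in> Q - {C}" for D
        using uniq[of D] that CB by blast
      then show ?thesis using disjQC unfolding P_def disjoint_def by blast
    qed
    moreover have "{} \<notin> P" using Q(3) CB by (auto simp: P_def)
    moreover have "card P = Suc k" using cardQC BQ finQ by (simp add: P_def)
    ultimately have "P \<in> partitions_into A (Suc k)"
      by (simp add: partitions_into_def partition_on_def)
    moreover have "B \<in> P" by (simp add: P_def)
    moreover have "Q = insert (insert a B) (P - {B})"
      using BQ C CB by (auto simp: P_def)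
    ultimately have "Q \<in> ?R2" by force
    then show ?thesis ..
  qed
next
  fix Q assume "Q \<in> ?R1 \<union> ?R2"
  then show "Q \<in> ?L"
  proof
    assume "Q \<in> ?R1"
    then obtain P where P: "\<Union>P = A" "disjoint P" "{} \<notin> P" "card P = k" "Q = insert {a} P"
      by (auto simp: partitions_into_def partition_on_def)
    have "finite P" using P(1) A finite_UnionD by blast
    moreover have "{a} \<notin> P" using P(1) a by blast
    moreover have "disjoint Q" using P(1,2,5) a by (auto simp: disjoint_def)
    ultimately show ?thesis using P by (simp add: partitions_into_def partition_on_def)
  next
    assume "Q \<in> ?R2"
    then obtain P B where P: "\<Union>P = A" "disjoint P" "{} \<notin> P" "card P = Suc k" "B \<in> P"
        "Q = insert (insert a B) (P - {B})"
      by (auto simp: partitions_into_def partition_on_def)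
    have finP: "finite P" using P(1) A finite_UnionD by blast
    have "insert a B \<notin> P" using P(1) a by blast
    then have "card Q = Suc k" using P(4,5,6) finP by simp
    moreover have "disjoint Q"
    proof -
      have "D \<inter> insert a B = {}" if "D \<in> P - {B}" for D
        using P(1,2,5) a that by (auto simp: disjoint_def)
      moreover have "disjoint (P - {B})" using P(2) by (auto simp: disjoint_def)
      ultimately show ?thesis unfolding P(6) disjoint_def by blast
    qed
    moreover have "\<Union>Q = insert a A" using P(1,5,6) by blast
    moreover have "{} \<notin> Q" using P(3,6) by blast
    ultimately show ?thesis by (simp add: partitions_into_def partition_on_def)
  qed
qed

theorem card_partitions_into:
  assumes "finite A"
  shows "card (partitions_into A k) = Stirling (card A) k"
  using assms
proof (induction A arbitrary: k rule: finite_induct)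
  case empty
  have "partitions_into ({} :: 'a set) k = (if k = 0 then {{}} else {})" for k :: nat
    by (auto simp: partitions_into_def partition_on_empty)
  then show ?case by (cases k) auto
next
  case (insert a A)
  show ?case
  proof (cases k)
    case 0
    have "P = {}" if "partition_on (insert a A) P" "card P = 0" for P
    proof -
      have "finite P"
        using that(1) insert.hyps(1) by (auto simp: partition_on_def intro: finite_UnionD)
      then show ?thesis using that(2) by simp
    qed
    then have "partitions_into (insert a A) 0 = {}"
      by (auto simp: partitions_into_def partition_on_def)
    then show ?thesis using 0 insert.hyps by simp
  next
    case (Suc j)
    let ?f = "\<lambda>(P, B). insert (insert a B) (P - {B})"
    let ?S = "SIGMA P:partitions_into A (Suc j). P"
    let ?g = "insert {a} ` partitions_into A j"
    have noa: "a \<notin> D" if "P \<in> partitions_into A i" "D \<in> P" for P D i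
      using that insert.hyps(2) by (auto simp: partitions_into_def partition_on_def)
    have fin: "finite P" "card P = i" if "P \<in> partitions_into A i" for P i
      using that insert.hyps(1) by (auto simp: partitions_into_def partition_on_def intro: finite_UnionD)
    have inj1: "inj_on (insert {a}) (partitions_into A j)"
      by (rule inj_onI) (metis insertI1 insert_ident noa)
    have inj2: "inj_on ?f ?S"
    proof (rule inj_on_inverseI[where
            g = "\<lambda>Q. ((\<lambda>D. D - {a}) ` Q, (THE C. C \<in> Q \<and> a \<in> C) - {a})"])
      fix x assume "x \<in> ?S"
      then obtain P B where x: "x = (P, B)" "P \<in> partitions_into A (Suc j)" "B \<in> P" by blast
      have n: "a \<notin> D" if "D \<in> P" for D using noa x that by blast
      have "(THE C. C \<in> ?f x \<and> a \<in> C) = insert a B"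
        by (rule the_equality) (use x n in auto)
      moreover have "(\<lambda>D. D - {a}) ` (P - {B}) = P - {B}" using n by force
      ultimately show "((\<lambda>D. D - {a}) ` ?f x, (THE C. C \<in> ?f x \<and> a \<in> C) - {a}) = x"
        using x n[of B] by auto
    qed
    have disj: "?g \<inter> ?f ` ?S = {}"
    proof -
      have False if P: "P \<in> partitions_into A (Suc j)" "B \<in> P"
        and eq: "{a} \<in> insert (insert a B) (P - {B})" for P B
      proof -
        have "B = {}" using eq noa[OF P] noa[OF P(1), of "{a}"] by auto
        then show False using P by (auto simp: partitions_into_def partition_on_def)
      qed
      then show ?thesis by fastforce
    qed
    have "card (partitions_into (insert a A) (Suc j)) = card ?g + card (?f ` ?S)"
      unfolding partitions_into_insert[OF insert.hyps]
      by (rule card_Un_disjoint)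
         (use insert.hyps finite_partitions_into fin disj in \<open>auto intro!: finite_imageI finite_SigmaI\<close>)
    also have "card ?g = Stirling (card A) j"
      using card_image[OF inj1] insert.IH by simp
    also have "card (?f ` ?S) = card ?S"
      by (rule card_image[OF inj2])
    also have "card ?S = (\<Sum>P\<in>partitions_into A (Suc j). card P)"
      by (rule card_SigmaI) (use insert.hyps finite_partitions_into fin in auto)
    also have "\<dots> = (\<Sum>P\<in>partitions_into A (Suc j). Suc j)"
      by (rule sum.cong) (use fin in auto)
    also have "\<dots> = Suc j * Stirling (card A) (Suc j)"
      using insert.IH by simp
    finally show ?thesis using Suc insert.hyps by simp
  qed
qed

end

theory Submission
  imports Defs "HOL-Computational_Algebra.Formal_Power_Series"
begin

text \<open>
  The exponential generating function of the ordered Bell numbers is \<open>1 / (2 - e\<^sup>x)\<close>, whose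
  dominant singularity is the simple pole at \<open>c = ln 2\<close>. The asymptotics can be extracted without
  complex analysis. Rescaling \<open>x\<close> by \<open>c\<close> moves the pole to \<open>1\<close>, so that the coefficients
  \<open>b\<^sub>m = Bell(m) c\<^sup>m / m!\<close> form a series \<open>B\<close> with \<open>B * (2 - exp (c X)) = 1\<close>. Because
  \<open>2 - exp (c X)\<close> vanishes at \<open>1\<close>, it factors as \<open>(1 - X) * Q\<close>, where \<open>Q\<close> has the nonnegative
  coefficients \<open>2 - (\<Sum>j\<le>n. c\<^sup>j / j!)\<close>, the tails of the exponential series.

  The coefficients of \<open>(1 - X) * B = 1 / Q\<close> are the increments of \<open>b\<close>, so \<open>b\<^sub>m\<close> converges to
  \<open>1 / Q(1)\<close> as soon as \<open>1 / Q\<close> has absolutely summable coefficients. In general this needs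
  Wiener's lemma, but here \<open>Q\<close> has constant term \<open>1\<close> and
  \<open>Q(1) = c e\<^sup>c = 2 ln 2 < 2\<close>: the constant term dominates the others,
  and a geometric-series type estimate is enough (\<open>summable_fps_inverse\<close>). The limit
  \<open>1 / (2 ln 2)\<close> of \<open>b\<^sub>m\<close> is the claim.
\<close>

unbundle fps_syntax

section \<open>The exponential generating function\<close>

text \<open>
  Differentiating \<open>(e\<^bsup>cx\<^esup> - 1)\<^bsup>k+1\<^esup>\<close> gives \<open>c (k + 1)\<close> times
  \<open>(e\<^bsup>cx\<^esup> - 1)\<^bsup>k+1\<^esup> + (e\<^bsup>cx\<^esup> - 1)\<^sup>k\<close>, and on coefficients this is the Stirling recurrence.
\<close>

lemma fps_nth_exp_minus_1_power:
  fixes c :: "'a :: field_char_0"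
  shows "((fps_exp c - 1) ^ k) $ m * fact m = c ^ m * of_nat (Stirling m k * fact k)"
proof (induction m arbitrary: k)
  case 0
  show ?case by (cases k) (simp_all add: fps_nth_power_0)
next
  case (Suc m)
  let ?U = "fps_exp c - 1 :: 'a fps"
  show ?case
  proof (cases k)
    case 0
    then show ?thesis by simp
  next
    case (Suc j)
    have "fps_deriv (?U ^ k) = fps_const (c * of_nat k) * (?U ^ k + ?U ^ j)"
      unfolding fps_deriv_power Suc
      by (simp add: algebra_simps del: of_nat_Suc flip: fps_const_mult)
    then have "of_nat (Suc m) * (?U ^ k) $ Suc m = c * of_nat k * ((?U ^ k) $ m + (?U ^ j) $ m)"
      by (metis Suc_eq_plus1 fps_add_nth fps_deriv_nth fps_mult_left_const_nth)
    moreover have "(?U ^ k) $ Suc m * fact (Suc m) = of_nat (Suc m) * (?U ^ k) $ Suc m * fact m"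
      by (simp add: ac_simps del: of_nat_Suc)
    ultimately have "(?U ^ k) $ Suc m * fact (Suc m)
        = c * of_nat k * ((?U ^ k) $ m * fact m + (?U ^ j) $ m * fact m)"
      by (simp only: distrib_right mult.assoc)
    then show ?thesis
      unfolding Suc.IH by (simp add: Suc algebra_simps)
  qed
qed

text \<open>
  This is the geometric series in \<open>U = e\<^bsup>cx\<^esup> - 1\<close>. As \<open>U\<close> has no constant term, \<open>U\<^sup>k\<close>
  contributes only to coefficients of index at least \<open>k\<close>, so finite partial sums suffice.
\<close>

lemma ordered_Bell_egf:
  fixes c :: "'a :: field_char_0"
  shows "Abs_fps (\<lambda>m. of_nat (ordered_Bell m) * c ^ m / fact m) * (2 - fps_exp c) = 1"
    (is "?B * _ = 1")
proof (rule fps_ext)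
  fix n
  let ?U = "fps_exp c - 1 :: 'a fps"
  define G where "G = (\<Sum>k\<le>n. ?U ^ k)"
  have coeff: "?B $ i = G $ i" if "i \<le> n" for i
  proof -
    have "G $ i = (\<Sum>k\<le>n. c ^ i * of_nat (Stirling i k * fact k) / fact i)"
      unfolding G_def fps_sum_nth
      by (rule sum.cong) (simp_all add: nonzero_eq_divide_eq fps_nth_exp_minus_1_power)
    also have "\<dots> = (\<Sum>k\<in>{0..i}. c ^ i * of_nat (Stirling i k * fact k) / fact i)"
      by (rule sum.mono_neutral_right) (use that in auto)
    also have "\<dots> = ?B $ i"
      by (simp add: ordered_Bell_def sum_distrib_left sum_divide_distrib mult.commute)
    finally show ?thesis ..
  qed
  have "(?B * (2 - fps_exp c)) $ n = (G * (2 - fps_exp c)) $ n"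
    unfolding fps_mult_nth by (rule sum.cong) (use coeff in auto)
  also have "G * (2 - fps_exp c) = 1 - ?U ^ Suc n"
  proof -
    have "G * (1 - ?U) = 1 - ?U ^ Suc n"
      using sum_gp_basic[of ?U n] by (simp add: G_def mult.commute)
    moreover have "1 - ?U = 2 - fps_exp c" by simp
    ultimately show ?thesis by simp
  qed
  also have "(1 - ?U ^ Suc n) $ n = (1 :: 'a fps) $ n"
    using startsby_zero_power_prefix[of ?U "Suc n"] by simp
  finally show "(?B * (2 - fps_exp c)) $ n = (1 :: 'a fps) $ n" .
qed

section \<open>Reciprocals of series dominated by their constant term\<close>

text \<open>
  Let \<open>S\<close> and \<open>T\<close> be the \<open>N\<close>th partial sums of \<open>\<Sum>\<bar>D\<^sub>n\<bar>\<close> and \<open>\<Sum>\<bar>Q\<^sub>n\<bar>\<close>. Solving \<open>D * Q = 1\<close> for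
  the term \<open>D\<^sub>n * Q\<^sub>0 = D\<^sub>n\<close> and summing yields \<open>S \<le> 1 + (T - 1) S\<close>, and hence
  \<open>S \<le> 1 / (2 - T)\<close>, which is bounded because \<open>T\<close> stays away from \<open>2\<close>.
\<close>

lemma summable_fps_inverse:
  fixes D Q :: "real fps"
  assumes DQ: "D * Q = 1" and Q0: "Q $ 0 = 1"
    and sumQ: "summable (\<lambda>n. \<bar>Q $ n\<bar>)" and less2: "(\<Sum>n. \<bar>Q $ n\<bar>) < 2"
  shows "summable (\<lambda>n. \<bar>D $ n\<bar>)"
proof (rule bounded_imp_summable)
  fix N
  let ?T = "\<Sum>n. \<bar>Q $ n\<bar>" and ?S = "\<Sum>n\<le>N. \<bar>D $ n\<bar>"
  have pointwise: "2 * \<bar>D $ n\<bar> \<le> (if n = 0 then 1 else 0) + (\<Sum>i\<le>n. \<bar>Q $ i\<bar> * \<bar>D $ (n - i)\<bar>)" for n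
  proof -
    have "(if n = 0 then 1 else 0) = (\<Sum>i\<le>n. Q $ i * D $ (n - i))"
      using arg_cong[OF DQ, of "\<lambda>f. f $ n"]
      by (simp add: fps_mult_nth mult.commute[of D] atLeast0AtMost)
    also have "\<dots> = D $ n + (\<Sum>i<n. Q $ Suc i * D $ (n - Suc i))"
      by (simp add: sum.atMost_shift Q0)
    finally have "\<bar>D $ n\<bar> \<le> (if n = 0 then 1 else 0) + \<bar>\<Sum>i<n. Q $ Suc i * D $ (n - Suc i)\<bar>"
      by (auto split: if_splits)
    also have "\<dots> \<le> (if n = 0 then 1 else 0) + (\<Sum>i<n. \<bar>Q $ Suc i\<bar> * \<bar>D $ (n - Suc i)\<bar>)"
      by (intro add_left_mono order.trans[OF sum_abs]) (simp add: abs_mult)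
    finally show ?thesis by (simp add: sum.atMost_shift Q0)
  qed
  have "2 * ?S \<le> (\<Sum>n\<le>N. (if n = 0 then 1 else 0) + (\<Sum>i\<le>n. \<bar>Q $ i\<bar> * \<bar>D $ (n - i)\<bar>))"
    unfolding sum_distrib_left by (intro sum_mono pointwise)
  also have "\<dots> = 1 + (\<Sum>n\<le>N. \<Sum>i\<le>n. \<bar>Q $ i\<bar> * \<bar>D $ (n - i)\<bar>)"
    by (simp add: sum.distrib)
  also have "(\<Sum>n\<le>N. \<Sum>i\<le>n. \<bar>Q $ i\<bar> * \<bar>D $ (n - i)\<bar>)
      = (\<Sum>(i, j)\<in>{(i, j). i + j \<le> N}. \<bar>Q $ i\<bar> * \<bar>D $ j\<bar>)"
    by (simp add: sum.triangle_reindex_eq)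
  also have "\<dots> \<le> (\<Sum>(i, j)\<in>{..N} \<times> {..N}. \<bar>Q $ i\<bar> * \<bar>D $ j\<bar>)"
    by (rule sum_mono2) auto
  also have "\<dots> = (\<Sum>i\<le>N. \<bar>Q $ i\<bar>) * ?S"
    by (simp add: sum_product sum.cartesian_product)
  also have "\<dots> \<le> ?T * ?S"
    by (intro mult_right_mono sum_le_suminf sumQ sum_nonneg) auto
  finally have "(2 - ?T) * ?S \<le> 1" by (simp add: algebra_simps)
  then show "?S \<le> 1 / (2 - ?T)" using less2 by (simp add: field_simps)
qed simp

text \<open>
  The coefficients of \<open>B\<close> are the partial sums of those of \<open>D = (1 - X) * B\<close>, and \<open>D * Q = 1\<close>.
  With both series absolutely convergent, the Cauchy product evaluates this identity at \<open>1\<close>.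
\<close>

lemma fps_nth_tendsto_of_simple_pole:
  fixes B Q :: "real fps"
  assumes BQ: "B * ((1 - fps_X) * Q) = 1" and Q0: "Q $ 0 = 1"
    and sumQ: "summable (\<lambda>n. \<bar>Q $ n\<bar>)" and less2: "(\<Sum>n. \<bar>Q $ n\<bar>) < 2"
  shows "(\<lambda>n. B $ n) \<longlonglongrightarrow> 1 / (\<Sum>n. Q $ n)"
proof -
  define D where "D = (1 - fps_X) * B"
  have DQ: "D * Q = 1" using BQ by (simp add: D_def algebra_simps)
  have sumD: "summable (\<lambda>n. \<bar>D $ n\<bar>)"
    by (rule summable_fps_inverse[OF DQ Q0 sumQ less2])
  have "(\<lambda>n. \<Sum>i\<le>n. D $ i * Q $ (n - i)) sums ((\<Sum>n. D $ n) * (\<Sum>n. Q $ n))"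
    by (rule Cauchy_product_sums) (use sumD sumQ in auto)
  moreover have "(\<lambda>n. \<Sum>i\<le>n. D $ i * Q $ (n - i)) = (\<lambda>n. if n = 0 then 1 else 0)"
    using arg_cong[OF DQ, of fps_nth] by (simp add: fun_eq_iff fps_mult_nth atLeast0AtMost)
  moreover have "(\<lambda>n. if n = 0 then 1 else 0 :: real) sums 1"
    using sums_single[of 0 "\<lambda>_. 1 :: real"] by simp
  ultimately have "(\<Sum>n. D $ n) * (\<Sum>n. Q $ n) = 1"
    by (metis sums_unique2)
  then have limit: "(\<Sum>n. D $ n) = 1 / (\<Sum>n. Q $ n)"
    by (metis mult_zero_right nonzero_eq_divide_eq zero_neq_one)
  have "(\<Sum>i\<le>n. D $ i) = B $ n" for n
    by (induction n) (simp_all add: D_def left_diff_distrib)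
  moreover have "(\<lambda>n. \<Sum>i\<le>n. D $ i) \<longlonglongrightarrow> (\<Sum>n. D $ n)"
    by (rule summable_LIMSEQ') (use sumD summable_rabs_cancel in blast)
  ultimately show ?thesis by (simp add: limit)
qed

section \<open>Tails of the exponential series at \<open>ln 2\<close>\<close>

text \<open>The constant \<open>2\<close> is the full sum \<open>e\<^bsup>ln 2\<^esup>\<close>, so these are the sums over \<open>j > n\<close>.\<close>

definition exp_ln2_tail :: "nat \<Rightarrow> real" where
  "exp_ln2_tail n = 2 - (\<Sum>j\<le>n. ln 2 ^ j / fact j)"

text \<open>
  The tail is a Lagrange remainder \<open>e\<^sup>t (ln 2)\<^bsup>n+1\<^esup> / (n + 1)!\<close> with \<open>t \<le> ln 2\<close>.
\<close>

lemma exp_ln2_tail_bounds: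
  shows exp_ln2_tail_nonneg: "0 \<le> exp_ln2_tail n"
    and exp_ln2_tail_le: "exp_ln2_tail n \<le> 2 * ln 2 ^ Suc n / fact (Suc n)"
proof -
  obtain t where t: "\<bar>t\<bar> \<le> \<bar>ln 2 :: real\<bar>"
    "exp (ln 2 :: real) = (\<Sum>m<Suc n. ln 2 ^ m / fact m) + exp t / fact (Suc n) * ln 2 ^ Suc n"
    using Maclaurin_exp_le[of "ln 2" "Suc n"] by blast
  have tail: "exp_ln2_tail n = exp t * (ln 2 ^ Suc n / fact (Suc n))"
    using t(2) by (simp add: exp_ln2_tail_def lessThan_Suc_atMost)
  show "0 \<le> exp_ln2_tail n" unfolding tail by simp
  have "t \<le> ln 2" using t(1) by simp
  then have "exp t \<le> exp (ln 2)" by (simp only: exp_le_cancel_iff)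
  then have "exp t \<le> 2" by simp
  then have "exp t * (ln 2 ^ Suc n / fact (Suc n)) \<le> 2 * (ln 2 ^ Suc n / fact (Suc n) :: real)"
    by (rule mult_right_mono) simp
  then show "exp_ln2_tail n \<le> 2 * ln 2 ^ Suc n / fact (Suc n)" unfolding tail by simp
qed

lemma exp_ln2_tail_fps:
  "(1 - fps_X) * Abs_fps exp_ln2_tail = 2 - fps_exp (ln 2)"
proof (rule fps_ext)
  fix n
  show "((1 - fps_X) * Abs_fps exp_ln2_tail) $ n = (2 - fps_exp (ln 2 :: real)) $ n"
    by (cases n) (simp_all add: left_diff_distrib exp_ln2_tail_def fps_numeral_nth distrib_right)
qed

text \<open>
  Exchanging the order of summation in the double series of tails counts the term
  \<open>c\<^sup>j / j!\<close> with multiplicity \<open>j\<close>, for \<open>c = ln 2\<close>, and so gives \<open>c e\<^sup>c = 2 c\<close>. Summation by parts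
  makes this precise, with a boundary term that vanishes in the limit.
\<close>

lemma exp_ln2_tail_sums: "exp_ln2_tail sums (2 * ln 2)"
proof -
  have parts: "(\<Sum>k<n. exp_ln2_tail k)
      = real n * exp_ln2_tail n + ln 2 * (\<Sum>j<n. ln 2 ^ j / fact j)" for n
  proof (induction n)
    case (Suc n)
    have "real (Suc n) * (exp_ln2_tail n - exp_ln2_tail (Suc n)) = ln 2 * (ln 2 ^ n / fact n)"
      by (simp add: exp_ln2_tail_def del: of_nat_Suc)
    then show ?case
      unfolding sum.lessThan_Suc Suc.IH by (simp add: algebra_simps)
  qed simp
  have boundary: "(\<lambda>n. real n * exp_ln2_tail n) \<longlonglongrightarrow> 0"
  proof (rule tendsto_sandwich[OF _ _ tendsto_const])
    show "\<forall>\<^sub>F n in sequentially. 0 \<le> real n * exp_ln2_tail n"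
      by (simp add: exp_ln2_tail_nonneg)
    have "real n * exp_ln2_tail n \<le> 2 * ln 2 ^ Suc n" for n
    proof -
      have "real n * exp_ln2_tail n \<le> real n * (2 * ln 2 ^ Suc n / fact (Suc n))"
        by (intro mult_left_mono exp_ln2_tail_le) simp
      also have "\<dots> = 2 * ln 2 ^ Suc n * (real n / fact (Suc n))" by simp
      also have "real n \<le> fact (Suc n)"
        using fact_ge_self[of "Suc n"] by (metis Suc_leD of_nat_fact of_nat_le_iff)
      then have "2 * ln 2 ^ Suc n * (real n / fact (Suc n)) \<le> 2 * ln 2 ^ Suc n * 1"
        by (intro mult_left_mono) simp_all
      finally show ?thesis by simp
    qed
    then show "\<forall>\<^sub>F n in sequentially. real n * exp_ln2_tail n \<le> 2 * ln 2 ^ Suc n"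
      by simp
    have "(\<lambda>n. (ln 2 :: real) ^ n) \<longlonglongrightarrow> 0"
      by (rule LIMSEQ_power_zero) (use ln_2_less_1 in simp)
    then show "(\<lambda>n. 2 * (ln 2 :: real) ^ Suc n) \<longlonglongrightarrow> 0"
      by (intro tendsto_mult_right_zero LIMSEQ_Suc)
  qed
  have "(\<lambda>n. \<Sum>j<n. (ln 2 :: real) ^ j / fact j) \<longlonglongrightarrow> 2"
    using exp_converges[of "ln 2 :: real"] by (simp add: sums_def divide_inverse mult.commute)
  then have "(\<lambda>n. real n * exp_ln2_tail n + ln 2 * (\<Sum>j<n. ln 2 ^ j / fact j)) \<longlonglongrightarrow> 0 + ln 2 * 2"
    by (intro tendsto_intros boundary)
  then show ?thesis by (simp add: sums_def parts mult.commute)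
qed

section \<open>Asymptotics\<close>

theorem proposition4p3:
  shows "(\<lambda>m::nat. real (ordered_Bell m)) \<sim>[at_top]
           (\<lambda>m. fact m / (2 * (ln 2) ^ (m + 1)))"
proof (rule asymp_equivI')
  let ?B = "Abs_fps (\<lambda>m. real (ordered_Bell m) * ln 2 ^ m / fact m)"
  let ?Q = "Abs_fps exp_ln2_tail"
  have abs_Q: "(\<lambda>n. \<bar>?Q $ n\<bar>) = exp_ln2_tail"
    by (simp add: exp_ln2_tail_nonneg)
  have "(\<lambda>n. ?B $ n) \<longlonglongrightarrow> 1 / (\<Sum>n. ?Q $ n)"
  proof (rule fps_nth_tendsto_of_simple_pole)
    show "?B * ((1 - fps_X) * ?Q) = 1"
      unfolding exp_ln2_tail_fps by (rule ordered_Bell_egf)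
    show "?Q $ 0 = 1" by (simp add: exp_ln2_tail_def)
    show "summable (\<lambda>n. \<bar>?Q $ n\<bar>)"
      unfolding abs_Q using exp_ln2_tail_sums by (rule sums_summable)
    show "(\<Sum>n. \<bar>?Q $ n\<bar>) < 2"
      unfolding abs_Q using sums_unique[OF exp_ln2_tail_sums] ln_2_less_1 by simp
  qed
  then have "(\<lambda>m. real (ordered_Bell m) * ln 2 ^ m / fact m) \<longlonglongrightarrow> 1 / (2 * ln 2)"
    using sums_unique[OF exp_ln2_tail_sums] by simp
  then have "(\<lambda>m. 2 * ln 2 * (real (ordered_Bell m) * ln 2 ^ m / fact m))
      \<longlonglongrightarrow> 2 * ln 2 * (1 / (2 * ln 2))"
    by (rule tendsto_mult_left)
  then show "(\<lambda>m. real (ordered_Bell m) / (fact m / (2 * ln 2 ^ (m + 1)))) \<longlonglongrightarrow> 1"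
    by (simp add: field_simps)
qed

end
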